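(* For the Petersen graph $P$, we have $b^A_g(P)=-1$.
   Context: The balance game on a finite simple graph $G$ is played by two players, Admirable (A) and Impish (I), who alternately select a not-yet-labeled vertex of $G$ until all vertices are labeled; Admirable labels each vertex she selects by $0$ and Impish labels each vertex he selects by $1$. Each edge receives the sum modulo $2$ of the labels of its endpoints. Let $e_0$ and $e_1$ be the numbers of edges labeled $0$ and $1$ at the end; the discrepancy is $d=e_1-e_0$. Admirable tries to minimize $d$ and Impish tries to maximize $d$. $b^A_g(G)$ is the value of $d$ under optimal play of both players when Admirable moves first. *)

theory Defs
  imports Main
begin

text \<open>A graph is a pair of a vertex set and a set of edges, each edge being the set of its
  two endpoints.\<close>

type_synonym 'a graph = "'a set \<times> 'a set set"

abbreviation verts :: "'a graph \<Rightarrow> 'a set" where "verts \<equiv> fst"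
abbreviation edges :: "'a graph \<Rightarrow> 'a set set" where "edges \<equiv> snd"

definition finite_simple_graph :: "'a graph \<Rightarrow> bool" where
  "finite_simple_graph G \<longleftrightarrow>
     finite (verts G) \<and> (\<forall>e\<in>edges G. e \<subseteq> verts G \<and> card e = 2)"

datatype player = Admirable | Impish

fun opponent :: "player \<Rightarrow> player" where
  "opponent Admirable = Impish"
| "opponent Impish = Admirable"

fun player_label :: "player \<Rightarrow> nat" where
  "player_label Admirable = 0"
| "player_label Impish = 1"

text \<open>A position of the game is a partial labeling; its domain is the set of vertices already
  labeled. The next two notions are meant for labelings defined on all vertices.\<close>

definition edge_label :: "('a \<rightharpoonup> nat) \<Rightarrow> 'a set \<Rightarrow> nat" where
  "edge_label L e = (\<Sum>v\<in>e. the (L v)) mod 2"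

definition discrepancy :: "'a graph \<Rightarrow> ('a \<rightharpoonup> nat) \<Rightarrow> int" where
  "discrepancy G L =
     int (card {e \<in> edges G. edge_label L e = 1}) - int (card {e \<in> edges G. edge_label L e = 0})"

text \<open>\<open>game_value G n p L\<close> is the final discrepancy under optimal play from position \<open>L\<close>
  when \<open>p\<close> is to move and exactly \<open>n\<close> vertices are still unlabeled. With \<open>G\<close> finite and
  \<open>n\<close> equal to the number of unlabeled vertices, \<open>Min\<close> and \<open>Max\<close> below are always taken over
  finite nonempty sets.\<close>

primrec game_value :: "'a graph \<Rightarrow> nat \<Rightarrow> player \<Rightarrow> ('a \<rightharpoonup> nat) \<Rightarrow> int" where
  "game_value G 0 p L = discrepancy G L"
| "game_value G (Suc n) p L =
     (case p of Admirable \<Rightarrow> Min | Impish \<Rightarrow> Max)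
       ((\<lambda>v. game_value G n (opponent p) (L(v \<mapsto> player_label p))) ` (verts G - dom L))"

definition bgA :: "'a graph \<Rightarrow> int" where
  "bgA G = game_value G (card (verts G)) Admirable Map.empty"

text \<open>Outer 5-cycle on \<open>0..4\<close>, inner pentagram on \<open>5..9\<close>, and spokes joining \<open>i\<close> to
  \<open>i + 5\<close>.\<close>

definition petersen :: "nat graph" where
  "petersen = ({0..<10},
     (\<lambda>i. {i, (i + 1) mod 5}) ` {0..<5} \<union>
     (\<lambda>i. {i, i + 5}) ` {0..<5} \<union>
     (\<lambda>i. {i + 5, (i + 2) mod 5 + 5}) ` {0..<5})"

lemma petersen_edges:
  "edges petersen =
     {{0,1},{1,2},{2,3},{3,4},{4,0},
      {0,5},{1,6},{2,7},{3,8},{4,9},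
      {5,7},{6,8},{7,9},{8,5},{9,6}}"
proof -
  have "{0..<5::nat} = {0,1,2,3,4}" by auto
  then show ?thesis by (simp add: petersen_def insert_commute numeral_2_eq_2)
qed

lemma finite_simple_graph_petersen: "finite_simple_graph petersen"
proof -
  have "verts petersen = {0..<10}" by (simp add: petersen_def)
  then show ?thesis by (simp add: finite_simple_graph_def petersen_edges)
qed

end

theory Submission
  imports Defs
begin

text \<open>Since the Petersen graph is cubic, a final position in which Admirable owns the five vertices
  \<open>A\<close> has discrepancy \<open>15 - 4 e(A)\<close>, where \<open>e(A)\<close> counts the edges inside \<open>A\<close>. The claim is thus
  that optimal play gives \<open>e(A) = 4\<close>.

  Admirable always takes a free neighbour of her own vertices. A connected set of
  \<open>k \<le> 4\<close> vertices has more than \<open>k\<close> outside neighbours while Impish owns only \<open>k\<close> vertices, so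
  this is always possible, and she ends with a tree. Conversely, \<open>e(A) = 5\<close> only
  if \<open>A\<close> is a 5-cycle. Once Admirable owns four vertices, at most one vertex completes
  them to a 5-cycle, and Impish takes it: two completing vertices would give six vertices
  with at least seven edges, and then the other four vertices would span at least four
  edges, which is impossible as the girth is five.\<close>

section \<open>Edges induced by a vertex set\<close>

definition induced_size :: "'a graph \<Rightarrow> 'a set \<Rightarrow> nat" where
  "induced_size G A = card {e \<in> edges G. e \<subseteq> A}"

lemma finite_edges:
  assumes "finite_simple_graph G"
  shows "finite (edges G)"
proof (rule finite_subset)
  show "edges G \<subseteq> Pow (verts G)" "finite (Pow (verts G))"
    using assms by (auto simp: finite_simple_graph_def)
qed

lemma induced_size_insert:
  assumes "finite_simple_graph G" "finite A" "v \<notin> A"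
  shows "induced_size G (insert v A) = induced_size G A + card {u \<in> A. {u, v} \<in> edges G}"
proof -
  let ?S = "{u \<in> A. {u, v} \<in> edges G}"
  have "{e \<in> edges G. e \<subseteq> insert v A} = {e \<in> edges G. e \<subseteq> A} \<union> (\<lambda>u. {u, v}) ` ?S"
  proof (intro equalityI subsetI)
    fix e assume e: "e \<in> {e \<in> edges G. e \<subseteq> insert v A}"
    then have "card e = 2" using assms(1) by (auto simp: finite_simple_graph_def)
    then obtain x y where "e = {x, y}" "x \<noteq> y" by (auto simp: card_2_iff)
    then show "e \<in> {e \<in> edges G. e \<subseteq> A} \<union> (\<lambda>u. {u, v}) ` ?S"
      using e by (auto simp: insert_commute)
  qed auto
  moreover have "inj_on (\<lambda>u. {u, v}) ?S"
    by (auto simp: inj_on_def doubleton_eq_iff)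
  moreover have "{e \<in> edges G. e \<subseteq> A} \<inter> (\<lambda>u. {u, v}) ` ?S = {}"
    using assms(3) by auto
  ultimately show ?thesis
    using assms finite_edges[OF assms(1)]
    by (simp add: induced_size_def card_Un_disjoint card_image)
qed

section \<open>Edge counts in the Petersen graph\<close>

lemma verts_petersen: "verts petersen = {0..<10}"
  by (simp add: petersen_def)

lemma finite_verts_petersen: "finite (verts petersen)"
  by (simp add: verts_petersen)

lemma card_edges_petersen: "card (edges petersen) = 15"
  by (simp add: petersen_edges doubleton_eq_iff)

lemma petersen_edge:
  assumes "e \<in> edges petersen"
  obtains u v where "e = {u, v}" "u \<noteq> v" "u \<in> {0..<10}" "v \<in> {0..<10}"
  using assms finite_simple_graph_petersen
  by (auto simp: finite_simple_graph_def verts_petersen card_2_iff)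

text \<open>Double counting: every vertex lies on exactly three edges.\<close>

lemma sum_petersen_edges:
  fixes f :: "nat \<Rightarrow> int"
  shows "(\<Sum>e\<in>edges petersen. \<Sum>v\<in>e. f v) = 3 * (\<Sum>v\<in>{0..<10}. f v)"
proof -
  have "{0..<10::nat} = {0,1,2,3,4,5,6,7,8,9}" by auto
  then show ?thesis by (simp add: petersen_edges doubleton_eq_iff)
qed

lemma induced_size_petersen_sum:
  "int (induced_size petersen A) = (\<Sum>e\<in>edges petersen. of_bool (e \<subseteq> A))"
  using finite_edges[OF finite_simple_graph_petersen]
  by (simp add: induced_size_def of_bool_def sum.If_cases Int_def)

lemma induced_size_petersen_compl:
  assumes "A \<subseteq> {0..<10}"
  shows "induced_size petersen ({0..<10} - A) + 3 * card A = induced_size petersen A + 15"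
proof -
  let ?E = "edges petersen"
  let ?z = "\<lambda>v. of_bool (v \<in> A) :: int"
  \<comment> \<open>According as \<open>e\<close> has 0, 1 or 2 ends in \<open>A\<close>, the right
    side is 0+1-0, 0+1-1 or 1+1-2.\<close>
  have "(of_bool (e \<subseteq> {0..<10} - A) :: int) = of_bool (e \<subseteq> A) + 1 - (\<Sum>v\<in>e. ?z v)" if "e \<in> ?E" for e
    using that by (rule petersen_edge) auto
  then have "int (induced_size petersen ({0..<10} - A))
      = (\<Sum>e\<in>?E. of_bool (e \<subseteq> A) + 1 - (\<Sum>v\<in>e. ?z v))"
    unfolding induced_size_petersen_sum by (rule sum.cong[OF refl])
  also have "\<dots> = int (induced_size petersen A) + 15 - 3 * (\<Sum>v\<in>{0..<10}. ?z v)"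
    by (simp add: sum.distrib sum_subtractf sum_petersen_edges induced_size_petersen_sum card_edges_petersen)
  also have "(\<Sum>v\<in>{0..<10}. ?z v) = int (card A)"
    using assms by (simp add: of_bool_def sum.If_cases Int_absorb1)
  finally show ?thesis by linarith
qed

section \<open>Exhaustive checks over vertex sets\<close>

definition petersen_nbrs :: "nat \<Rightarrow> nat list" where
  "petersen_nbrs v =
     [[1,4,5],[0,2,6],[1,3,7],[2,4,8],[3,0,9],[0,7,8],[1,8,9],[2,5,9],[3,5,6],[4,6,7]] ! v"

lemma set_petersen_nbrs:
  assumes "v < 10"
  shows "u \<in> set (petersen_nbrs v) \<longleftrightarrow> {u, v} \<in> edges petersen"
proof -
  have "v \<in> {0,1,2,3,4,5,6,7,8,9}" using assms by auto
  then show ?thesis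
    by (elim insertE emptyE; simp add: petersen_nbrs_def petersen_edges doubleton_eq_iff; blast)
qed

text \<open>An executable form of \<open>induced_size\<close> for lists of distinct vertices, which
  \<open>code_simp\<close> can evaluate.\<close>

fun induced_count :: "nat list \<Rightarrow> nat" where
  "induced_count [] = 0"
| "induced_count (v # vs) =
     induced_count vs + (let N = petersen_nbrs v in length (filter (\<lambda>u. u \<in> set N) vs))"

lemma induced_count_eq:
  assumes "distinct vs" "set vs \<subseteq> {0..<10}"
  shows "induced_count vs = induced_size petersen (set vs)"
  using assms
proof (induction vs)
  case Nil
  then show ?case by (auto simp: induced_size_def petersen_edges)
next
  case (Cons v vs)
  then have "length (filter (\<lambda>u. u \<in> set (petersen_nbrs v)) vs) = card {u \<in> set vs. {u, v} \<in> edges petersen}"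
    by (simp add: set_petersen_nbrs distinct_length_filter Int_def conj_commute)
  with Cons show ?case
    by (simp add: induced_size_insert[OF finite_simple_graph_petersen])
qed

lemma list_of_subset:
  assumes "A \<subseteq> {0..<n}"
  obtains vs where "vs \<in> set (subseqs [0..<n])" "set vs = A" "distinct vs" "length vs = card A"
proof -
  have "A \<in> set ` set (subseqs [0..<n])"
    using assms by (simp add: subseqs_powset)
  then show ?thesis
    using that subseqs_distinctD distinct_upt distinct_card by (metis imageE)
qed

text \<open>By the girth, the sets of at most four vertices with \<open>card A \<le> e(A) + 1\<close> are exactly the
  subtrees and the empty set; a vertex with \<open>card A \<le> e(insert v A)\<close> attaches to such a subtree.\<close>

lemma tree_expansion_check:
  "list_all (\<lambda>vs. length vs \<le> 4 \<longrightarrow> length vs \<le> induced_count vs + 1 \<longrightarrow>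
     length vs < length (filter (\<lambda>v. v \<notin> set vs \<and> length vs \<le> induced_count (v # vs)) [0..<10]))
   (subseqs [0..<10])"
  by code_simp

text \<open>The girth is five, so four vertices span a forest.\<close>

lemma four_vertices_check:
  "list_all (\<lambda>vs. length vs = 4 \<longrightarrow> induced_count vs \<le> 3) (subseqs [0..<10])"
  by code_simp

lemma tree_expansion:
  assumes "A \<subseteq> {0..<10}" "card A \<le> 4" "card A \<le> induced_size petersen A + 1"
  shows "card A < card {v \<in> {0..<10} - A. card A \<le> induced_size petersen (insert v A)}"
proof -
  obtain vs where vs: "vs \<in> set (subseqs [0..<10])" "set vs = A" "distinct vs" "length vs = card A"
    using assms(1) by (rule list_of_subset)
  let ?P = "\<lambda>v. v \<notin> set vs \<and> length vs \<le> induced_count (v # vs)"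
  have "length vs \<le> 4" "length vs \<le> induced_count vs + 1"
    using vs assms by (simp_all add: induced_count_eq)
  then have "length vs < length (filter ?P [0..<10])"
    using tree_expansion_check vs(1) unfolding list_all_iff by blast
  also have "length (filter ?P [0..<10]) = card {v \<in> {0..<10}. ?P v}"
    by (simp add: distinct_length_filter Int_def conj_commute)
  also have "{v \<in> {0..<10}. ?P v} = {v \<in> {0..<10} - A. card A \<le> induced_size petersen (insert v A)}"
    \<comment> \<open>Keeping \<open>induced_count (v # vs)\<close> folded lets
      \<open>induced_count_eq\<close> apply to the whole list.\<close>
    using vs assms(1) by (auto simp: induced_count_eq simp del: induced_count.simps)
  finally show ?thesis using vs by simp
qed

lemma induced_size_four:
  assumes "A \<subseteq> {0..<10}" "card A = 4"
  shows "induced_size petersen A \<le> 3"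
proof -
  obtain vs where "vs \<in> set (subseqs [0..<10])" "set vs = A" "distinct vs" "length vs = card A"
    using assms(1) by (rule list_of_subset)
  then show ?thesis
    using four_vertices_check assms by (auto simp: list_all_iff induced_count_eq)
qed

lemma five_cycle_completion_unique:
  assumes "A \<subseteq> {0..<10}" "card A = 4" "v \<in> {0..<10} - A" "w \<in> {0..<10} - A"
    and "5 \<le> induced_size petersen (insert v A)" "5 \<le> induced_size petersen (insert w A)"
  shows "v = w"
proof (rule ccontr)
  assume "v \<noteq> w"
  let ?e = "induced_size petersen"
  let ?d = "\<lambda>B v. card {u \<in> B. {u, v} \<in> edges petersen}"
  note ins = induced_size_insert[OF finite_simple_graph_petersen]
  have fin: "finite A" using assms(1) finite_subset by blast
  have v: "?e (insert v A) = ?e A + ?d A v" and w: "?e (insert w A) = ?e A + ?d A w"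
    using assms(3,4) fin by (simp_all add: ins)
  have "?e (insert v (insert w A)) = ?e (insert w A) + ?d (insert w A) v"
    using assms(3,4) fin \<open>v \<noteq> w\<close> by (simp add: ins)
  moreover have "?d A v \<le> ?d (insert w A) v"
    using fin by (intro card_mono) auto
  moreover have "?e A \<le> 3"
    using assms(1,2) by (rule induced_size_four)
  \<comment> \<open>The set \<open>insert w A\<close> has at least 5 edges, and \<open>v\<close> has
    at least 5 - 3 neighbours in \<open>A\<close>.\<close>
  ultimately have "7 \<le> ?e (insert v (insert w A))"
    using v w assms(5,6) by linarith
  moreover have B: "insert v (insert w A) \<subseteq> {0..<10}" "card (insert v (insert w A)) = 6"
    using assms(1-4) fin \<open>v \<noteq> w\<close> by auto
  moreover have "?e ({0..<10} - insert v (insert w A)) \<le> 3"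
    using B by (intro induced_size_four) (auto simp only: card_Diff_subset finite_subset[OF B(1)] card_atLeastLessThan finite_atLeastLessThan)
  \<comment> \<open>The complement formula would give the other four vertices at least 7 + 15 - 18 =
    4 edges.\<close>
  ultimately show False
    using induced_size_petersen_compl[OF B(1)] by simp
qed

section \<open>Bounds from single moves\<close>

lemma Admirable_le:
  assumes "finite (verts G)" "v \<in> verts G - dom L"
    and "game_value G n Impish (L(v \<mapsto> 0)) \<le> c"
  shows "game_value G (Suc n) Admirable L \<le> c"
  using assms by (auto intro!: Min.coboundedI[THEN order_trans])

lemma le_Admirable:
  assumes "finite (verts G)" "verts G - dom L \<noteq> {}"
    and "\<And>v. v \<in> verts G - dom L \<Longrightarrow> c \<le> game_value G n Impish (L(v \<mapsto> 0))"
  shows "c \<le> game_value G (Suc n) Admirable L"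
  using assms by simp

lemma Impish_le:
  assumes "finite (verts G)" "verts G - dom L \<noteq> {}"
    and "\<And>v. v \<in> verts G - dom L \<Longrightarrow> game_value G n Admirable (L(v \<mapsto> 1)) \<le> c"
  shows "game_value G (Suc n) Impish L \<le> c"
  using assms by simp

lemma le_Impish:
  assumes "finite (verts G)" "v \<in> verts G - dom L"
    and "c \<le> game_value G n Admirable (L(v \<mapsto> 1))"
  shows "c \<le> game_value G (Suc n) Impish L"
  using assms by (auto intro!: Max.coboundedI[THEN order_trans[rotated]])

section \<open>Positions after complete rounds\<close>

definition labelled :: "nat \<Rightarrow> ('a \<rightharpoonup> nat) \<Rightarrow> 'a set" where
  "labelled i L = {v. L v = Some i}"

text \<open>Describes positions after \<open>k\<close> full rounds; the condition on
  \<open>dom L\<close> excludes labels other than 0 and 1.\<close>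

definition balanced :: "'a graph \<Rightarrow> nat \<Rightarrow> ('a \<rightharpoonup> nat) \<Rightarrow> bool" where
  "balanced G k L \<longleftrightarrow> dom L \<subseteq> verts G \<and> dom L = labelled 0 L \<union> labelled 1 L \<and>
     card (labelled 0 L) = k \<and> card (labelled 1 L) = k"

lemma labelled_upd:
  "v \<notin> dom L \<Longrightarrow> labelled i (L(v \<mapsto> j)) = (if i = j then insert v (labelled i L) else labelled i L)"
  by (auto simp: labelled_def dom_def)

lemma labelled_subset_dom: "labelled i L \<subseteq> dom L"
  by (auto simp: labelled_def)

lemma balanced_empty: "balanced G 0 Map.empty"
  by (simp add: balanced_def labelled_def)

lemma balanced_card_dom:
  assumes "finite (verts G)" "balanced G k L"
  shows "card (dom L) = 2 * k"
proof -
  have "labelled 0 L \<inter> labelled 1 L = {}" by (auto simp: labelled_def)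
  moreover have "finite (dom L)" using assms finite_subset by (auto simp: balanced_def)
  ultimately show ?thesis
    using assms(2) by (auto simp: balanced_def card_Un_disjoint)
qed

lemma balanced_round:
  assumes "finite (verts G)" "balanced G k L" "v \<in> verts G - dom L" "w \<in> verts G - dom L - {v}"
  shows "balanced G (Suc k) (L(v \<mapsto> 0, w \<mapsto> 1))"
    and "labelled 0 (L(v \<mapsto> 0, w \<mapsto> 1)) = insert v (labelled 0 L)"
proof -
  have fin: "finite (labelled i L)" for i
    using assms(1,2) labelled_subset_dom finite_subset by (metis balanced_def)
  have "v \<notin> labelled 0 L" "w \<notin> labelled 1 L"
    using assms(3,4) labelled_subset_dom by fastforce+
  then show "balanced G (Suc k) (L(v \<mapsto> 0, w \<mapsto> 1))"
    using assms fin by (auto simp: balanced_def labelled_upd)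
  show "labelled 0 (L(v \<mapsto> 0, w \<mapsto> 1)) = insert v (labelled 0 L)"
    using assms(3,4) by (simp add: labelled_upd)
qed

lemma petersen_free:
  assumes "balanced petersen k L"
  shows "card ({0..<10} - dom L) = 10 - 2 * k"
proof -
  have "dom L \<subseteq> {0..<10}" "card (dom L) = 2 * k"
    using assms balanced_card_dom[OF _ assms] by (auto simp only: balanced_def verts_petersen finite_atLeastLessThan)
  then show ?thesis
    using finite_subset by (subst card_Diff_subset) auto
qed

text \<open>An edge gets 0 iff its ends have the same owner. Both owners hold five vertices, so by
  the complement formula both sets span equally many edges.\<close>

lemma discrepancy_petersen:
  assumes "balanced petersen 5 L"
  shows "discrepancy petersen L = 15 - 4 * int (induced_size petersen (labelled 0 L))"
proof -
  let ?E = "edges petersen" and ?Z = "labelled 0 L"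
  let ?Zero = "{e \<in> ?E. edge_label L e = 0}" and ?One = "{e \<in> ?E. edge_label L e = 1}"
  have finE: "finite ?E" by (rule finite_edges[OF finite_simple_graph_petersen])
  have "{0..<10} - dom L = {}"
    using petersen_free[OF assms] by simp
  then have dom: "dom L = {0..<10}"
    using assms unfolding balanced_def verts_petersen by blast
  then have Z: "?Z \<subseteq> {0..<10}"
    using labelled_subset_dom by metis
  have "edge_label L e = 0 \<longleftrightarrow> e \<subseteq> ?Z \<or> e \<subseteq> {0..<10} - ?Z" if "e \<in> ?E" for e
    using that
  proof (rule petersen_edge)
    fix u v assume e: "e = {u, v}" "u \<noteq> v" "u \<in> {0..<10}" "v \<in> {0..<10}"
    then have "u \<in> labelled 0 L \<union> labelled 1 L" "v \<in> labelled 0 L \<union> labelled 1 L"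
      using assms unfolding balanced_def dom by blast+
    then show ?thesis using e by (auto simp: edge_label_def labelled_def)
  qed
  then have zero: "?Zero = {e \<in> ?E. e \<subseteq> ?Z} \<union> {e \<in> ?E. e \<subseteq> {0..<10} - ?Z}" by auto
  \<comment> \<open>Only an empty edge could lie in both \<open>?Z\<close> and its
    complement.\<close>
  have "e \<noteq> {}" if "e \<in> ?E" for e using that by (rule petersen_edge) auto
  then have "card ?Zero = induced_size petersen ?Z + induced_size petersen ({0..<10} - ?Z)"
    unfolding zero induced_size_def using finE by (subst card_Un_disjoint) auto
  moreover have "card ?Zero + card ?One = 15"
  proof -
    have "?E = ?Zero \<union> ?One" by (auto simp: edge_label_def)
    then have "card ?E = card (?Zero \<union> ?One)" by (rule arg_cong)
    also have "\<dots> = card ?Zero + card ?One" using finE by (intro card_Un_disjoint) auto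
    finally show ?thesis by (simp add: card_edges_petersen)
  qed
  ultimately show ?thesis
    using induced_size_petersen_compl[OF Z] assms by (simp add: discrepancy_def balanced_def)
qed

section \<open>Strategies of the two players\<close>

text \<open>Induction on the remaining rounds \<open>m\<close>. The third hypothesis is Admirable's
  invariant; at \<open>k = 5\<close> it yields four edges, hence discrepancy at most 15 -
  16.\<close>

lemma petersen_upper:
  assumes "balanced petersen k L" "k + m = 5" "k \<le> induced_size petersen (labelled 0 L) + 1"
  shows "game_value petersen (2 * m) Admirable L \<le> - 1"
  using assms
proof (induction m arbitrary: k L)
  case 0
  then show ?case by (simp add: discrepancy_petersen)
next
  case (Suc m)
  let ?Z = "labelled 0 L"
  let ?F = "{0..<10} - dom L"
  let ?X = "{v \<in> {0..<10} - ?Z. k \<le> induced_size petersen (insert v ?Z)}"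
  have bal: "dom L \<subseteq> {0..<10}" "dom L = ?Z \<union> labelled 1 L" "card ?Z = k" "card (labelled 1 L) = k"
    using Suc.prems(1) unfolding balanced_def verts_petersen by blast+
  \<comment> \<open>Impish owns only \<open>k\<close> vertices, so he cannot have blocked all of
    \<open>?X\<close>.\<close>
  have "card (labelled 1 L) < card ?X"
    using tree_expansion[of ?Z] bal Suc.prems by auto
  then have "\<not> ?X \<subseteq> labelled 1 L"
    using bal(1,2) by (metis card_mono finite_Un finite_atLeastLessThan finite_subset not_less)
  then obtain v where v: "v \<in> ?F" "k \<le> induced_size petersen (insert v ?Z)"
    using bal by auto
  \<comment> \<open>The number of free vertices is even, so Impish still has a move after
    \<open>v\<close>.\<close>
  have "card (?F - {v}) = card ?F - 1" using v by simp
  then have "card (?F - {v}) \<noteq> 0"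
    using petersen_free[OF Suc.prems(1)] Suc.prems(2) by simp
  then have ne: "?F - {v} \<noteq> {}" by force
  have "game_value petersen (Suc (2 * m)) Impish (L(v \<mapsto> 0)) \<le> - 1"
  proof (rule Impish_le)
    fix w assume "w \<in> verts petersen - dom (L(v \<mapsto> 0))"
    then have w: "w \<in> verts petersen - dom L - {v}" by auto
    note round = balanced_round[OF finite_verts_petersen Suc.prems(1) v(1)[folded verts_petersen] w]
    show "game_value petersen (2 * m) Admirable (L(v \<mapsto> 0, w \<mapsto> 1)) \<le> - 1"
    proof (rule Suc.IH[OF round(1)])
      show "Suc k + m = 5" using Suc.prems(2) by simp
      show "Suc k \<le> induced_size petersen (labelled 0 (L(v \<mapsto> 0, w \<mapsto> 1))) + 1"
        unfolding round(2) using v(2) by simp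
    qed
  qed (use ne in \<open>auto simp: verts_petersen\<close>)
  then show ?case
    using v Admirable_le[of petersen v L "Suc (2 * m)"] by (simp add: verts_petersen del: game_value.simps)
qed

text \<open>The critical reply of Impish is the one to Admirable's fourth move (\<open>k = 3\<close>); his other
  moves are arbitrary.\<close>

lemma petersen_lower:
  assumes "balanced petersen k L" "k + m = 5"
    and "k = 4 \<Longrightarrow> \<forall>v \<in> {0..<10} - dom L. induced_size petersen (insert v (labelled 0 L)) \<le> 4"
    and "k = 5 \<Longrightarrow> induced_size petersen (labelled 0 L) \<le> 4"
  shows "- 1 \<le> game_value petersen (2 * m) Admirable L"
  using assms
proof (induction m arbitrary: k L)
  case 0
  then show ?case by (simp add: discrepancy_petersen)
next
  case (Suc m)
  let ?Z = "labelled 0 L"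
  let ?F = "{0..<10} - dom L"
  have bal: "dom L \<subseteq> {0..<10}" "card ?Z = k"
    using Suc.prems(1) unfolding balanced_def verts_petersen by blast+
  have cardF: "card ?F \<ge> 2"
    using petersen_free[OF Suc.prems(1)] Suc.prems(2) by simp
  then have neF: "?F \<noteq> {}" by force
  have Z: "?Z \<subseteq> dom L" by (rule labelled_subset_dom)
  have "- 1 \<le> game_value petersen (Suc (Suc (2 * m))) Admirable L"
  proof (rule le_Admirable)
    fix v assume "v \<in> verts petersen - dom L"
    then have v: "v \<in> ?F" by (simp add: verts_petersen)
    let ?A = "insert v ?Z"
    let ?bad = "\<lambda>u. 5 \<le> induced_size petersen (insert u ?A)"
    have "card (?F - {v}) \<noteq> 0" using v cardF by simp
    then have ne: "?F - {v} \<noteq> {}" by force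
    have unique: "u = w" if "k = 3" "u \<in> ?F - {v}" "w \<in> ?F - {v}" "?bad u" "?bad w" for u w
    proof (rule five_cycle_completion_unique[of ?A])
      have "finite ?Z"
        using finite_subset[OF order_trans[OF Z bal(1)]] by simp
      moreover have "v \<notin> ?Z" using Z v by blast
      ultimately show "card ?A = 4" using bal(2) that(1) by simp
      show "?A \<subseteq> {0..<10}" using Z bal(1) v by blast
      show "u \<in> {0..<10} - ?A" "w \<in> {0..<10} - ?A" using that(2,3) Z by blast+
    qed (fact that(4,5))+
    \<comment> \<open>For \<open>k = 3\<close>, Impish takes the only vertex completing a 5-cycle,
      if there is one; otherwise any free vertex serves.\<close>
    have "\<exists>w \<in> ?F - {v}. \<forall>u \<in> ?F - {v}. k = 3 \<longrightarrow> ?bad u \<longrightarrow> u = w"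
    proof (cases "\<exists>w \<in> ?F - {v}. k = 3 \<and> ?bad w")
      case True
      then obtain w where "w \<in> ?F - {v}" "k = 3" "?bad w" by blast
      then show ?thesis using unique by (intro bexI[of _ w]) blast+
    next
      case False
      then show ?thesis using ne by blast
    qed
    then obtain w where w: "w \<in> ?F - {v}"
      and good: "k = 3 \<Longrightarrow> u \<in> ?F - {v} \<Longrightarrow> ?bad u \<Longrightarrow> u = w" for u
      by blast
    have w': "w \<in> verts petersen - dom L - {v}" using w by (simp add: verts_petersen)
    note round = balanced_round[OF finite_verts_petersen Suc.prems(1) v[folded verts_petersen] w']
    have "- 1 \<le> game_value petersen (2 * m) Admirable (L(v \<mapsto> 0, w \<mapsto> 1))"
    proof (rule Suc.IH[OF round(1)])
      show "Suc k + m = 5" using Suc.prems(2) by simp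
      show "\<forall>u \<in> {0..<10} - dom (L(v \<mapsto> 0, w \<mapsto> 1)).
          induced_size petersen (insert u (labelled 0 (L(v \<mapsto> 0, w \<mapsto> 1)))) \<le> 4" if "Suc k = 4"
        using good that unfolding round(2) by (force simp: not_less_eq_eq)
      \<comment> \<open>Here \<open>k = 4\<close>: Impish's previous reply already made every choice
        of \<open>v\<close> harmless.\<close>
      show "induced_size petersen (labelled 0 (L(v \<mapsto> 0, w \<mapsto> 1))) \<le> 4" if "Suc k = 5"
        using Suc.prems(3) that v unfolding round(2) by simp
    qed
    then show "- 1 \<le> game_value petersen (Suc (2 * m)) Impish (L(v \<mapsto> 0))"
      using w by (intro le_Impish[of _ w]) (auto simp: verts_petersen)
  qed (use neF in \<open>simp_all add: verts_petersen\<close>)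
  then show ?case by simp
qed

theorem theorem2p8: "bgA petersen = - 1"
proof (rule antisym)
  have "bgA petersen = game_value petersen (2 * 5) Admirable Map.empty"
    by (simp add: bgA_def verts_petersen)
  \<comment> \<open>At \<open>k = 0\<close> Admirable's invariant is trivial and the guarded
    hypotheses of \<open>petersen_lower\<close> are vacuous.\<close>
  then show "bgA petersen \<le> - 1" "- 1 \<le> bgA petersen"
    using petersen_upper[OF balanced_empty, of 5] petersen_lower[OF balanced_empty, of 5] by simp_all
qed

end
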